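(* Let $(P,\leq,{}',0,1)$ be a Boolean poset and define $M(x,y):=L(x,y)$ and $R(x,y):=L(U(x',y))$ for all $x,y\in P$. Then $(P,\leq,{}',M,R,0,1)$ is an operator residuated poset satisfying divisibility, i.e. $M(R(x,y),x)=L(x,y)$ for all $x,y\in P$.
   Context: For a poset $(P,\leq)$ and $A\subseteq P$ let $L(A)=\{x\in P\mid x\leq y\text{ for all }y\in A\}$ and $U(A)=\{x\in P\mid y\leq x\text{ for all }y\in A\}$; we write $L(a,b)$ for $L(\{a,b\})$, $L(A,a)$ for $L(A\cup\{a\})$, $L(A,B)$ for $L(A\cup B)$, etc., and similarly for $U$. A poset is distributive if $L(U(x,y),z)=L(U(L(x,z),L(y,z)))$ for all $x,y,z$ (equivalently $U(L(x,y),z)=U(L(U(x,z),U(y,z)))$). A poset with complementation is $(P,\leq,{}',0,1)$ with $(P,\leq,0,1)$ a bounded poset and $'$ a unary operation such that $L(x,x')=\{0\}$, $U(x,x')=\{1\}$, $x\leq y$ implies $y'\leq x'$, and $(x')'=x$. A Boolean poset is a distributive poset with complementation. An operator left residuated poset is a system $(P,\leq,{}',M,R,0,1)$ where $(P,\leq,0,1)$ is bounded, $'$ is a unary operation, and $M,R:P^2\to 2^P$ satisfy for all $x,y,z$: (1) $M(x,1)=M(1,x)=L(x)$; (2) $R(x,y)=P$ iff $x\leq y$; (3) $M(x,y)\subseteq L(z)$ iff $L(x)\subseteq R(y,z)$; (4) $R(x,0)=L(x')$. It is an operator residuated poset if moreover $M(x,y)=M(y,x)$ for all $x,y$. For $A,B\subseteq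 P$, $M(A,B):=\bigcup_{(x,y)\in A\times B}M(x,y)$ and $R(A,B):=\bigcup_{(x,y)\in A\times B}R(x,y)$; divisibility is the identity $M(R(x,y),x)=L(x,y)$. *)

theory Defs
  imports Main
begin

text \<open>
  A poset is a type of class \<^class>\<open>order\<close>, so \<open>P\<close> is \<^term>\<open>UNIV\<close>; a bounded poset is a type of sort
  \<open>{order_bot, order_top}\<close> with \<open>0\<close> and \<open>1\<close> rendered as \<^term>\<open>bot\<close> and \<^term>\<open>top\<close>.
  The variants with several arguments are written with unions, e.g. \<open>L(A,a)\<close> as \<open>L (A \<union> {a})\<close>.
\<close>

definition L :: "'a::order set \<Rightarrow> 'a set" where
  "L A = {x. \<forall>y\<in>A. x \<le> y}"

definition U :: "'a::order set \<Rightarrow> 'a set" where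
  "U A = {x. \<forall>y\<in>A. y \<le> x}"

locale complemented_poset =
  fixes compl :: "'a::{order_bot, order_top} \<Rightarrow> 'a"
  assumes L_compl: "L {x, compl x} = {bot}"
    and U_compl: "U {x, compl x} = {top}"
    and compl_antimono: "x \<le> y \<Longrightarrow> compl y \<le> compl x"
    and compl_compl: "compl (compl x) = x"

locale boolean_poset = complemented_poset compl
  for compl :: "'a::{order_bot, order_top} \<Rightarrow> 'a" +
  assumes distributive: "L (U {x :: 'a, y} \<union> {z}) = L (U (L {x, z} \<union> L {y, z}))"

locale operator_left_residuated_poset =
  fixes compl :: "'a::{order_bot, order_top} \<Rightarrow> 'a"
    and M :: "'a \<Rightarrow> 'a \<Rightarrow> 'a set"
    and R :: "'a \<Rightarrow> 'a \<Rightarrow> 'a set"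
  assumes M_top_right: "M x top = L {x}"
    and M_top_left: "M top x = L {x}"
    and R_eq_UNIV_iff: "R x y = UNIV \<longleftrightarrow> x \<le> y"
    and adjointness: "M x y \<subseteq> L {z} \<longleftrightarrow> L {x} \<subseteq> R y z"
    and R_bot: "R x bot = L {compl x}"

locale operator_residuated_poset = operator_left_residuated_poset compl M R
  for compl :: "'a::{order_bot, order_top} \<Rightarrow> 'a"
    and M :: "'a \<Rightarrow> 'a \<Rightarrow> 'a set"
    and R :: "'a \<Rightarrow> 'a \<Rightarrow> 'a set" +
  assumes M_commute: "M x y = M y x"

definition set_extension :: "('a \<Rightarrow> 'a \<Rightarrow> 'a set) \<Rightarrow> 'a set \<Rightarrow> 'a set \<Rightarrow> 'a set" where
  "set_extension F A B = (\<Union>(x, y)\<in>A \<times> B. F x y)"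

definition divisible :: "('a::order \<Rightarrow> 'a \<Rightarrow> 'a set) \<Rightarrow> ('a \<Rightarrow> 'a \<Rightarrow> 'a set) \<Rightarrow> bool" where
  "divisible M R \<longleftrightarrow> (\<forall>x y. set_extension M (R x y) {x} = L {x, y})"

end

theory Submission
  imports Defs
begin

text \<open>
  Everything rests on the adjointness \<open>L(x,y) \<subseteq> L(z) \<longleftrightarrow> x \<in> L(U(y',z))\<close>. Forwards, distributivity
  splits \<open>L(x) = L(U(y,y'),x)\<close> into the pieces \<open>L(y,x)\<close> and \<open>L(y',x)\<close>, which lie below \<open>z\<close> and \<open>y'\<close>;
  backwards, it gives \<open>L(U(y',z),y) = L(U(L(y',y),L(z,y)))\<close>, where \<open>L(y',y) = {0}\<close>.
\<close>

context boolean_poset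
begin

lemma L_subset_iff_mem_LU: "L {x, y} \<subseteq> L {z} \<longleftrightarrow> x \<in> L (U {compl y, z})"
proof
  assume le: "L {x, y} \<subseteq> L {z}"
  have "x \<in> L (U {y, compl y} \<union> {x})"
    by (simp add: U_compl L_def)
  then have x: "x \<in> L (U (L {y, x} \<union> L {compl y, x}))"
    by (simp only: distributive)
  have "U {compl y, z} \<subseteq> U (L {y, x} \<union> L {compl y, x})"
    using le by (fastforce simp: U_def L_def)
  with x show "x \<in> L (U {compl y, z})"
    by (auto simp: L_def)
next
  assume x: "x \<in> L (U {compl y, z})"
  show "L {x, y} \<subseteq> L {z}"
  proof
    fix w assume w: "w \<in> L {x, y}"
    then have "w \<in> L (U {compl y, z} \<union> {y})"
      using x by (auto simp: L_def dest: order_trans)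
    then have "w \<in> L (U (L {compl y, y} \<union> L {z, y}))"
      by (simp only: distributive)
    moreover have "z \<in> U (L {compl y, y} \<union> L {z, y})"
      using L_compl[of y] by (auto simp: U_def insert_commute) (auto simp: L_def)
    ultimately show "w \<in> L {z}"
      by (auto simp: L_def)
  qed
qed

text \<open>\<open>L (U A)\<close> is a down-set. This links the element form of adjointness proved
  above to the inclusion of \<open>L {x}\<close> that the residuation axiom asks for.\<close>

lemma principal_subset_LU_iff: "L {x} \<subseteq> L (U A) \<longleftrightarrow> x \<in> L (U A)"
  by (auto simp: L_def dest: order_trans)

text \<open>A down-set is everything iff it contains \<open>top\<close>, and adjointness at
  \<open>top\<close> leaves a condition on \<open>L {top, x}\<close>, whose greatest element is
  \<open>x\<close>.\<close>

lemma LU_compl_eq_UNIV_iff: "L (U {compl x, y}) = UNIV \<longleftrightarrow> x \<le> y"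
proof -
  have "L (U {compl x, y}) = UNIV \<longleftrightarrow> top \<in> L (U {compl x, y})"
    using order_trans[OF top_greatest] unfolding L_def by blast
  also have "\<dots> \<longleftrightarrow> L {top, x} \<subseteq> L {y}"
    by (simp add: L_subset_iff_mem_LU)
  also have "\<dots> \<longleftrightarrow> x \<le> y"
    by (auto simp: L_def)
  finally show ?thesis .
qed

lemma LU_compl_bot: "L (U {compl x, bot}) = L {compl x}"
  by (auto simp: L_def U_def dest: order_trans)

lemma operator_residuated:
  "operator_residuated_poset compl (\<lambda>x y. L {x, y}) (\<lambda>x y. L (U {compl x, y}))"
proof unfold_locales
  show "L {x, top} = L {x}" "L {top, x} = L {x}" for x :: 'a
    by (auto simp: L_def)
  show "L {x, y} = L {y, x}" for x y :: 'a
    by (simp add: insert_commute)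
qed (simp_all only: LU_compl_eq_UNIV_iff LU_compl_bot L_subset_iff_mem_LU principal_subset_LU_iff)

lemma divisible_LU: "divisible (\<lambda>x y. L {x, y}) (\<lambda>x y. L (U {compl x, y}))"
  unfolding divisible_def
proof (intro allI equalityI)
  fix x y :: 'a
  \<comment> \<open>By adjointness, every \<open>a\<close> in \<open>L (U {compl x, y})\<close>
    satisfies \<open>L {a, x} \<subseteq> L {y}\<close>.\<close>
  show "set_extension (\<lambda>x y. L {x, y}) (L (U {compl x, y})) {x} \<subseteq> L {x, y}"
    unfolding set_extension_def by (auto simp flip: L_subset_iff_mem_LU) (auto simp: L_def)
  \<comment> \<open>Each \<open>w\<close> in \<open>L {x, y}\<close> is its own witness:
    \<open>w \<le> y\<close> puts it in \<open>L (U {compl x, y})\<close>, and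
    \<open>w \<le> x\<close> gives \<open>w \<in> L {w, x}\<close>.\<close>
  show "L {x, y} \<subseteq> set_extension (\<lambda>x y. L {x, y}) (L (U {compl x, y})) {x}"
    by (auto simp: set_extension_def L_def U_def dest: order_trans)
qed

end

theorem theorem2:
  fixes compl :: "'a::{order_bot, order_top} \<Rightarrow> 'a"
    and M R :: "'a \<Rightarrow> 'a \<Rightarrow> 'a set"
  assumes "boolean_poset compl"
    and "\<And>x y. M x y = L {x, y}"
    and "\<And>x y. R x y = L (U {compl x, y})"
  shows "operator_residuated_poset compl M R \<and> divisible M R"
proof -
  have "M = (\<lambda>x y. L {x, y})" "R = (\<lambda>x y. L (U {compl x, y}))"
    using assms(2,3) by blast+
  then show ?thesis
    using boolean_poset.operator_residuated[OF assms(1)] boolean_poset.divisible_LU[OF assms(1)]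
    by simp
qed

end
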